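(* Axiom (D2) can fail in the completion $\Gamma_D[\mathcal A]$ of an ordered domain algebra $\mathcal A$: if $\mathcal A$ is the full proper ordered domain algebra over a base of four elements, then there is $A\in\Gamma_D[\mathcal A]$ such that $\mathbf{dom}_\gamma(A)\leq A;_\gamma A^{\smile_\gamma}$ fails, i.e. $A;_\gamma A^{\smile_\gamma}\not\subseteq\mathbf{dom}_\gamma(A)$.
   Context: The full proper ordered domain algebra over a base set $U$ has as elements all binary relations on $U$, ordered by $\subseteq$, with $x;y=\{(u,v):\exists w\,(u,w)\in x,(w,v)\in y\}$, $\mathbf{dom}(x)=\{(u,u):\exists v\,(u,v)\in x\}$, $\mathbf{ran}(x)=\{(v,v):\exists u\,(u,v)\in x\}$, $x^\smile=\{(v,u):(u,v)\in x\}$, $0=\emptyset$, $\mathbf{id}=\{(u,u):u\in U\}$. It is an ordered domain algebra; in particular it satisfies (D2): $\mathbf{dom}(a)\leq a;a^\smile$. For an ordered domain algebra $\mathcal A$ with underlying poset $(P,\leq)$ and $S\subseteq P$ put $S^\uparrow=\{p\in P:\exists s\in S,\ s\leq p\}$. An up-set $X$ of $P$ ($\emptyset$ allowed) is $\Gamma_D$-closed if $\{\mathbf{dom}(x);y;\mathbf{ran}(z):x,y,z\in X\}^\uparrow=X$, and $\Gamma_D(X)$ is the smallest $\Gamma_D$-closed up-set containing the up-set $X$. $\Gamma_D[\mathcal A]$ is the set of $\Gamma_D$-closed up-sets ordered by reverse inclusion ($C\leq D\iff C\supseteq D$), with operations $C;_\gamma D=\Gamma_D(\{c;d:c\in C,d\in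 D\}^\uparrow)$, $\mathbf{dom}_\gamma(C)=\Gamma_D(\{\mathbf{dom}(c):c\in C\}^\uparrow)$, $C^{\smile_\gamma}=\Gamma_D(\{c^\smile:c\in C\}^\uparrow)$. *)

theory Defs
  imports Main "HOL.Hull"
begin

record 'p oda =
  carrier :: "'p set"
  le :: "'p \<Rightarrow> 'p \<Rightarrow> bool"
  seq :: "'p \<Rightarrow> 'p \<Rightarrow> 'p"
  dm :: "'p \<Rightarrow> 'p"
  rg :: "'p \<Rightarrow> 'p"
  conv :: "'p \<Rightarrow> 'p"
  zero :: "'p"
  ident :: "'p"

definition full_oda :: "'a set \<Rightarrow> ('a rel) oda" where
  "full_oda U =
    \<lparr> carrier = Pow (U \<times> U),
      le = (\<subseteq>),
      seq = (O),
      dm = (\<lambda>x. Id_on (Domain x)),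
      rg = (\<lambda>x. Id_on (Range x)),
      conv = converse,
      zero = {},
      ident = Id_on U \<rparr>"

definition up :: "('p, 'm) oda_scheme \<Rightarrow> 'p set \<Rightarrow> 'p set" where
  "up P S = {p \<in> carrier P. \<exists>s\<in>S. le P s p}"

definition up_set :: "('p, 'm) oda_scheme \<Rightarrow> 'p set \<Rightarrow> bool" where
  "up_set P X \<longleftrightarrow>
    X \<subseteq> carrier P \<and> (\<forall>x\<in>X. \<forall>p\<in>carrier P. le P x p \<longrightarrow> p \<in> X)"

definition gamma_closed :: "('p, 'm) oda_scheme \<Rightarrow> 'p set \<Rightarrow> bool" where
  "gamma_closed P X \<longleftrightarrow>
    up_set P X \<and>
    up P {seq P (seq P (dm P x) y) (rg P z) | x y z. x \<in> X \<and> y \<in> X \<and> z \<in> X} = X"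

text \<open>In an ordered domain algebra the closed up-sets are stable under intersection, so the hull is
  the smallest closed up-set containing its argument; \<open>gamma_least\<close> below checks this for \<open>full_oda U\<close>.\<close>

definition gamma :: "('p, 'm) oda_scheme \<Rightarrow> 'p set \<Rightarrow> 'p set" where
  "gamma P X = gamma_closed P hull X"

definition gamma_carrier :: "('p, 'm) oda_scheme \<Rightarrow> 'p set set" where
  "gamma_carrier P = {C. gamma_closed P C}"

definition gamma_le :: "'p set \<Rightarrow> 'p set \<Rightarrow> bool" where
  "gamma_le C D \<longleftrightarrow> D \<subseteq> C"

definition gamma_comp :: "('p, 'm) oda_scheme \<Rightarrow> 'p set \<Rightarrow> 'p set \<Rightarrow> 'p set" where
  "gamma_comp P C D = gamma P (up P {seq P c d | c d. c \<in> C \<and> d \<in> D})"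

definition gamma_dom :: "('p, 'm) oda_scheme \<Rightarrow> 'p set \<Rightarrow> 'p set" where
  "gamma_dom P C = gamma P (up P (dm P ` C))"

definition gamma_conv :: "('p, 'm) oda_scheme \<Rightarrow> 'p set \<Rightarrow> 'p set" where
  "gamma_conv P C = gamma P (up P (conv P ` C))"

lemma full_oda_D2:
  "le (full_oda U) (dm (full_oda U) a) (seq (full_oda U) a (conv (full_oda U) a))"
  by (auto simp: full_oda_def)

lemma gamma_closed_full_oda_iff:
  "gamma_closed (full_oda U) X \<longleftrightarrow> up_set (full_oda U) X \<and>
    (\<forall>x\<in>X. \<forall>y\<in>X. \<forall>z\<in>X. (Id_on (Domain x) O y) O Id_on (Range z) \<in> X)"
  (is "?L \<longleftrightarrow> ?U \<and> ?R")
proof (cases ?U)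
  case True
  define T where
    "T = {(Id_on (Domain x) O y) O Id_on (Range z) | x y z. x \<in> X \<and> y \<in> X \<and> z \<in> X}"
  have car: "x \<subseteq> U \<times> U" if "x \<in> X" for x
    using True that by (auto simp: up_set_def full_oda_def)
  have mono: "p \<in> X" if "x \<in> X" "p \<subseteq> U \<times> U" "x \<subseteq> p" for x p
    using True that by (auto simp: up_set_def full_oda_def)
  have L: "?L \<longleftrightarrow> {p. p \<subseteq> U \<times> U \<and> (\<exists>s\<in>T. s \<subseteq> p)} = X"
    using True by (simp add: T_def gamma_closed_def up_def full_oda_def Pow_def)
  have TI: "(Id_on (Domain x) O y) O Id_on (Range z) \<in> T" if "x \<in> X" "y \<in> X" "z \<in> X" for x y z
    unfolding T_def
    by (rule CollectI, rule exI[of _ x], rule exI[of _ y], rule exI[of _ z], simp only: that simp_thms)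
  have R: "?R \<longleftrightarrow> T \<subseteq> X"
  proof
    assume ?R
    show "T \<subseteq> X"
    proof
      fix t assume "t \<in> T"
      then obtain x y z where "x \<in> X" "y \<in> X" "z \<in> X"
        and "t = (Id_on (Domain x) O y) O Id_on (Range z)"
        unfolding T_def by (elim CollectE exE conjE)
      with \<open>?R\<close> show "t \<in> X" by simp
    qed
  next
    assume T: "T \<subseteq> X"
    show ?R
    proof (intro ballI)
      fix x y z assume "x \<in> X" "y \<in> X" "z \<in> X"
      then show "(Id_on (Domain x) O y) O Id_on (Range z) \<in> X"
        by (rule subsetD[OF T TI])
    qed
  qed
  have XT: "\<exists>s\<in>T. s \<subseteq> x" if "x \<in> X" for x
  proof
    show "(Id_on (Domain x) O x) O Id_on (Range x) \<in> T"
      by (rule TI[OF that that that])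
  qed auto
  have TU: "t \<subseteq> U \<times> U" if "t \<in> T" for t
  proof -
    from that obtain x y z where "x \<in> X" "y \<in> X" "z \<in> X"
      and t: "t = (Id_on (Domain x) O y) O Id_on (Range z)"
      unfolding T_def by (elim CollectE exE conjE)
    have "t \<subseteq> y" unfolding t by auto
    then show ?thesis using car[OF \<open>y \<in> X\<close>] by simp
  qed
  have "?L \<longleftrightarrow> T \<subseteq> X"
    unfolding L
  proof
    assume "{p. p \<subseteq> U \<times> U \<and> (\<exists>s\<in>T. s \<subseteq> p)} = X"
    then show "T \<subseteq> X" using TU by (metis (lifting) mem_Collect_eq order_refl subsetI)
  next
    assume TX: "T \<subseteq> X"
    show "{p. p \<subseteq> U \<times> U \<and> (\<exists>s\<in>T. s \<subseteq> p)} = X"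
    proof (rule set_eqI)
      fix p
      show "p \<in> {p. p \<subseteq> U \<times> U \<and> (\<exists>s\<in>T. s \<subseteq> p)} \<longleftrightarrow> p \<in> X"
        using mono[OF subsetD[OF TX]] car[of p] XT[of p] by (simp only: mem_Collect_eq) metis
    qed
  qed
  then show ?thesis using True R by simp
qed (simp add: gamma_closed_def)

lemma gamma_least:
  assumes "X \<subseteq> carrier (full_oda U)"
  shows "gamma_closed (full_oda U) (gamma (full_oda U) X)"
    and "X \<subseteq> gamma (full_oda U) X"
    and "gamma_closed (full_oda U) Y \<Longrightarrow> X \<subseteq> Y \<Longrightarrow> gamma (full_oda U) X \<subseteq> Y"
proof -
  have top: "gamma_closed (full_oda U) (Pow (U \<times> U))"
    unfolding gamma_closed_full_oda_iff by (auto simp: up_set_def full_oda_def)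
  have X: "X \<subseteq> Pow (U \<times> U)" using assms by (simp add: full_oda_def)
  have "up_set (full_oda U) (gamma (full_oda U) X)"
    unfolding gamma_def hull_def up_set_def
  proof (intro conjI ballI impI)
    show "\<Inter> {t. gamma_closed (full_oda U) t \<and> X \<subseteq> t} \<subseteq> carrier (full_oda U)"
      using top X by (auto simp: full_oda_def)
  qed (auto simp: gamma_closed_def up_set_def)
  then show "gamma_closed (full_oda U) (gamma (full_oda U) X)"
    unfolding gamma_closed_full_oda_iff
    by (auto simp: gamma_def hull_def gamma_closed_full_oda_iff)
  show "X \<subseteq> gamma (full_oda U) X"
    by (simp add: gamma_def hull_subset)
  show "gamma_closed (full_oda U) Y \<Longrightarrow> X \<subseteq> Y \<Longrightarrow> gamma (full_oda U) X \<subseteq> Y"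
    by (simp add: gamma_def hull_minimal)
qed

end

theory Submission
  imports Defs
begin

text \<open>
  Let \<open>a\<close> be the identity and \<open>b\<close> the transposition on two points \<open>p\<close>, \<open>q\<close> of the base, and let
  \<open>A\<close> be the up-set generated by \<open>a\<close> and \<open>b\<close>. Since \<open>a\<close> and \<open>b\<close> have the same domain and the same
  range \<open>{p, q}\<close>, restricting a member of \<open>A\<close> to the domain and the range of other members removes
  nothing of the generator it contains; so \<open>A\<close> is closed, and so is the up-set of all relations
  containing the identity on \<open>{p, q}\<close>, which contains \<open>dom(c)\<close> for every \<open>c \<in> A\<close>. Axiom (D2)
  fails in the completion because the composition of \<open>A\<close> with its converse also combines
  \<^emph>\<open>different\<close> members of \<open>A\<close>: it contains \<open>a ; b\<^sup>\<smile> = b\<close>, which is disjoint from the identity.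
\<close>

text \<open>Up-sets generated by relations with common domain \<open>D\<close> and common range \<open>R\<close> are closed: a
  relation above a generator has at least \<open>D\<close> as domain and at least \<open>R\<close> as range, and a
  generator survives restriction to such sets.\<close>
lemma gamma_closed_up_common_domain_range:
  assumes "\<And>g. g \<in> G \<Longrightarrow> Domain g = D" and "\<And>g. g \<in> G \<Longrightarrow> Range g = R"
  shows "gamma_closed (full_oda U) (up (full_oda U) G)"
  unfolding gamma_closed_full_oda_iff
proof (intro conjI ballI)
  show "up_set (full_oda U) (up (full_oda U) G)"
    unfolding up_set_def up_def full_oda_def by simp blast
next
  fix x y z
  assume "x \<in> up (full_oda U) G" "y \<in> up (full_oda U) G" "z \<in> up (full_oda U) G"
  then obtain f g h where "f \<in> G" "f \<subseteq> x" and g: "g \<in> G" "g \<subseteq> y" and "h \<in> G" "h \<subseteq> z"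
    and yU: "y \<subseteq> U \<times> U"
    by (auto simp: up_def full_oda_def)
  then have "Domain g \<subseteq> Domain x" "Range g \<subseteq> Range z"
    using assms by (metis Domain_mono, metis Range_mono)
  then have "g \<subseteq> (Id_on (Domain x) O y) O Id_on (Range z)"
    using g by fast
  then show "(Id_on (Domain x) O y) O Id_on (Range z) \<in> up (full_oda U) G"
    using g yU by (auto simp: up_def full_oda_def)
qed

text \<open>The closure involved in the composition only adds elements, so products of members of \<open>C\<close> and
  \<open>D\<close> need no computation of it; dually, an upper bound for the domain needs only one closed
  up-set containing the domains.\<close>
lemma seq_in_gamma_comp:
  assumes "c \<in> C" "d \<in> D" "c \<subseteq> U \<times> U" "d \<subseteq> U \<times> U"
  shows "c O d \<in> gamma_comp (full_oda U) C D"
proof -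
  have "c O d \<in> up (full_oda U) {seq (full_oda U) c d | c d. c \<in> C \<and> d \<in> D}"
    using assms by (auto simp: up_def full_oda_def)
  then show ?thesis
    unfolding gamma_comp_def gamma_def by (rule hull_inc)
qed

lemma converse_in_gamma_conv:
  assumes "c \<in> C" "c \<subseteq> U \<times> U"
  shows "c\<inverse> \<in> gamma_conv (full_oda U) C"
proof -
  have "c\<inverse> \<in> up (full_oda U) (conv (full_oda U) ` C)"
    using assms by (auto simp: up_def full_oda_def)
  then show ?thesis
    unfolding gamma_conv_def gamma_def by (rule hull_inc)
qed

lemma gamma_dom_subset_up_Id_on:
  assumes "\<And>c. c \<in> C \<Longrightarrow> D \<subseteq> Domain c"
  shows "gamma_dom (full_oda U) C \<subseteq> up (full_oda U) {Id_on D}"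
  unfolding gamma_dom_def gamma_def
proof (rule hull_minimal)
  show "up (full_oda U) (dm (full_oda U) ` C) \<subseteq> up (full_oda U) {Id_on D}"
    using assms by (fastforce simp: up_def full_oda_def)
  show "gamma_closed (full_oda U) (up (full_oda U) {Id_on D})"
    by (rule gamma_closed_up_common_domain_range[where D = D and R = D]) auto
qed

lemma gamma_D2_fails_of_two_points:
  assumes "p \<in> U" "q \<in> U" "p \<noteq> q"
  shows "\<exists>A \<in> gamma_carrier (full_oda U).
    \<not> gamma_comp (full_oda U) A (gamma_conv (full_oda U) A) \<subseteq> gamma_dom (full_oda U) A"
proof -
  define a where "a = {(p, p), (q, q)}"
  define b where "b = {(p, q), (q, p)}"
  define A where "A = up (full_oda U) {a, b}"
  have aU: "a \<subseteq> U \<times> U" and bU: "b \<subseteq> U \<times> U"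
    using assms by (auto simp: a_def b_def)
  have aA: "a \<in> A" and bA: "b \<in> A"
    using aU bU by (auto simp: A_def up_def full_oda_def)
  have "A \<in> gamma_carrier (full_oda U)"
    unfolding A_def gamma_carrier_def mem_Collect_eq
    by (rule gamma_closed_up_common_domain_range[where D = "{p, q}" and R = "{p, q}"])
      (auto simp: a_def b_def)
  moreover have "a O b\<inverse> \<in> gamma_comp (full_oda U) A (gamma_conv (full_oda U) A)"
    using aU bU by (intro seq_in_gamma_comp converse_in_gamma_conv aA bA) auto
  moreover have "a O b\<inverse> \<notin> gamma_dom (full_oda U) A"
  proof
    assume "a O b\<inverse> \<in> gamma_dom (full_oda U) A"
    moreover have "gamma_dom (full_oda U) A \<subseteq> up (full_oda U) {Id_on {p, q}}"
      by (rule gamma_dom_subset_up_Id_on) (auto simp: A_def up_def full_oda_def a_def b_def)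
    ultimately have "Id_on {p, q} \<subseteq> a O b\<inverse>"
      by (auto simp: up_def full_oda_def)
    then show False
      using \<open>p \<noteq> q\<close> by (auto simp: a_def b_def)
  qed
  ultimately show ?thesis
    by blast
qed

theorem mainTheorem3:
  fixes U :: "'a set"
  assumes "card U = 4"
  shows "\<exists>A \<in> gamma_carrier (full_oda U).
    \<not> gamma_le (gamma_dom (full_oda U) A)
        (gamma_comp (full_oda U) A (gamma_conv (full_oda U) A)) \<and>
    \<not> gamma_comp (full_oda U) A (gamma_conv (full_oda U) A) \<subseteq> gamma_dom (full_oda U) A"
proof -
  have "\<not> card U \<le> Suc 0" and "finite U"
    using assms by (simp, intro card_ge_0_finite, simp)
  then obtain p q where "p \<in> U" "q \<in> U" "p \<noteq> q"
    by (auto simp: card_le_Suc0_iff_eq)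
  then show ?thesis
    unfolding gamma_le_def using gamma_D2_fails_of_two_points[of p U q] by simp
qed

end
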